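(* The following are equivalent: (1) All $\sigma$-projective games of length $\omega$ are determined. (2) All simple $\sigma$-projective games of length $\omega^2$ are determined. (3) All simple clopen games of length $\omega^2$ are determined.
   Context: A game of length $\alpha$ with payoff $A\subseteq\omega^\alpha$: players I and II alternate playing natural numbers, producing $x\in\omega^\alpha$; I wins iff $x\in A$. A game is determined if one of the players has a winning strategy. The $\sigma$-projective sets form the smallest pointclass (of subsets of the spaces $(\omega^\omega)^k$, $k\geq1$, with the product topology of discrete $\omega$) containing the open sets and closed under complements, countable unions (of sets in the same space), and projections. We identify $\omega^{\omega\cdot n}$ with $(\omega^\omega)^n$ and $\omega^{\omega^2}$ with $(\omega^\omega)^\omega$, and a set $A\subseteq\omega^{\omega\cdot n}$ with $\{x\in\omega^{\omega^2}:x\restriction\omega\cdot n\in A\}$. For a collection $\Gamma$ of such sets, the $\Gamma$-simple games of length $\omega^2$ are generated as follows: (i) for each $n\in\omega$, a game decided after $\omega\cdot n$ moves whose payoff, restricted to sequences of length $\omega\cdot n$, lies in $\Gamma$, is $\Gamma$-simple; (ii) if $n\in\omega$ and $G_i$ ($i\in\omega$) are $\Gamma$-simple, then the game in which I and II alternate for $\omega\cdot n$ moves, then Player I plays some $i\in\omega$, and then play continues according to the rules of $G_i$ (keeping the first $\omega\cdot n$ moves, but not $i$) is $\Gamma$-simple; (iii) the same as (ii) with Player II choosing $i$. "Simple clopen" means $\Gamma$-simple with $\Gamma$ the clopen sets; "simple $\sigma$-projective" means $\Gamma$-simple with $\Gamma$ the $\sigma$-projective sets. *)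

theory Defs
  imports "HOL-Analysis.Function_Topology"
begin

text \<open>The space \<open>(\<omega>\<^sup>\<omega>)\<^sup>k\<close>; its points are the extensional functions on \<open>{..<k}\<close> with values in
  \<open>nat \<Rightarrow> nat\<close>.\<close>

definition baire :: "(nat \<Rightarrow> nat) topology" where
  "baire = product_topology (\<lambda>_. discrete_topology UNIV) UNIV"

definition baire_pow :: "nat \<Rightarrow> (nat \<Rightarrow> nat \<Rightarrow> nat) topology" where
  "baire_pow k = product_topology (\<lambda>_. baire) {..<k}"

definition clopen :: "nat \<Rightarrow> (nat \<Rightarrow> nat \<Rightarrow> nat) set \<Rightarrow> bool" where
  "clopen k A \<longleftrightarrow> openin (baire_pow k) A \<and> closedin (baire_pow k) A"

text \<open>\<open>sigma_projective k A\<close>: \<open>A\<close> is a \<open>\<sigma>\<close>-projective subset of \<open>(\<omega>\<^sup>\<omega>)\<^sup>k\<close>.  The space has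
  \<open>k \<ge> 1\<close> throughout, and projections drop the last coordinate.\<close>

inductive sigma_projective :: "nat \<Rightarrow> (nat \<Rightarrow> nat \<Rightarrow> nat) set \<Rightarrow> bool" where
  sp_open: "k \<ge> 1 \<Longrightarrow> openin (baire_pow k) A \<Longrightarrow> sigma_projective k A"
| sp_compl: "sigma_projective k A \<Longrightarrow> sigma_projective k (topspace (baire_pow k) - A)"
| sp_Union: "(\<And>i::nat. sigma_projective k (A i)) \<Longrightarrow> sigma_projective k (\<Union>i. A i)"
| sp_proj: "k \<ge> 1 \<Longrightarrow> sigma_projective (Suc k) A \<Longrightarrow>
    sigma_projective k ((\<lambda>x. restrict x {..<k}) ` A)"

datatype player = PlayerI | PlayerII

text \<open>A play of a game whose length is the order type of a strict well-order \<open>r\<close> on \<open>'i\<close> is a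
  function \<open>x :: 'i \<Rightarrow> nat\<close>, and the position in which the \<open>j\<close>-th move is made is the restriction
  of \<open>x\<close> to the \<open>r\<close>-predecessors of \<open>j\<close>.  The component \<open>turn\<close> says who makes the \<open>j\<close>-th move
  in a given position.  It is part of the game because the moves \<open>i\<close> by which a subgame is chosen
  (see \<open>choice_game\<close>) interrupt the alternation of the players.\<close>

datatype 'i game = Game
  (turn: "'i \<Rightarrow> ('i \<Rightarrow> nat) \<Rightarrow> player")
  (payoff: "('i \<Rightarrow> nat) set")

definition position :: "('i \<times> 'i) set \<Rightarrow> ('i \<Rightarrow> nat) \<Rightarrow> 'i \<Rightarrow> ('i \<Rightarrow> nat)" where
  "position r x j = restrict x {k. (k, j) \<in> r}"

definition follows ::
  "('i \<times> 'i) set \<Rightarrow> 'i game \<Rightarrow> player \<Rightarrow> ('i \<Rightarrow> ('i \<Rightarrow> nat) \<Rightarrow> nat) \<Rightarrow> ('i \<Rightarrow> nat) \<Rightarrow> bool" where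
  "follows r G P s x \<longleftrightarrow>
    (\<forall>j. turn G j (position r x j) = P \<longrightarrow> x j = s j (position r x j))"

definition determined :: "('i \<times> 'i) set \<Rightarrow> 'i game \<Rightarrow> bool" where
  "determined r G \<longleftrightarrow>
    (\<exists>s. \<forall>x. follows r G PlayerI s x \<longrightarrow> x \<in> payoff G) \<or>
    (\<exists>s. \<forall>x. follows r G PlayerII s x \<longrightarrow> x \<notin> payoff G)"

text \<open>The ordinal \<open>\<omega>\<^sup>2\<close> is represented by the lexicographic order on \<open>nat \<times> nat\<close>, where \<open>(m, k)\<close>
  stands for \<open>\<omega> \<cdot> m + k\<close>.\<close>

abbreviation omega :: "(nat \<times> nat) set" where
  "omega \<equiv> less_than"

abbreviation omega_sq :: "((nat \<times> nat) \<times> (nat \<times> nat)) set" where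
  "omega_sq \<equiv> less_than <*lex*> less_than"

definition alternate :: "nat \<Rightarrow> player" where
  "alternate k = (if even k then PlayerI else PlayerII)"

text \<open>The alternating game of length \<open>\<omega>\<close> whose payoff is \<open>A \<subseteq> (\<omega>\<^sup>\<omega>)\<^sup>1\<close>, identified with a subset
  of \<open>\<omega>\<^sup>\<omega>\<close>.\<close>

definition omega_game :: "(nat \<Rightarrow> nat \<Rightarrow> nat) set \<Rightarrow> nat game" where
  "omega_game A = Game (\<lambda>k _. alternate k) {x. (\<lambda>_\<in>{..<1}. x) \<in> A}"

text \<open>The alternating game of length \<open>\<omega>\<^sup>2\<close> decided after \<open>\<omega> \<cdot> n\<close> moves by \<open>A \<subseteq> (\<omega>\<^sup>\<omega>)\<^sup>n\<close>; every
  limit position belongs to Player I.\<close>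

definition fixed_game :: "nat \<Rightarrow> (nat \<Rightarrow> nat \<Rightarrow> nat) set \<Rightarrow> (nat \<times> nat) game" where
  "fixed_game n A = Game (\<lambda>(m, k) _. alternate k) {x. (\<lambda>m\<in>{..<n}. \<lambda>k. x (m, k)) \<in> A}"

text \<open>Remove the move number \<open>\<omega> \<cdot> n\<close> from a play or position.\<close>

definition delete_move :: "nat \<Rightarrow> (nat \<times> nat \<Rightarrow> nat) \<Rightarrow> (nat \<times> nat \<Rightarrow> nat)" where
  "delete_move n x = (\<lambda>(m, k). if m = n then x (m, Suc k) else x (m, k))"

text \<open>The players alternate for \<open>\<omega> \<cdot> n\<close> moves; as move number \<open>\<omega> \<cdot> n\<close> player \<open>P\<close> chooses \<open>i\<close>; then
  they continue as in \<open>G i\<close>, where the position in \<open>G i\<close> (and who is to move there) is obtained by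
  forgetting \<open>i\<close>.  Thus the move following \<open>i\<close> is move number \<open>\<omega> \<cdot> n\<close> of \<open>G i\<close>.\<close>

definition choice_game ::
  "player \<Rightarrow> nat \<Rightarrow> (nat \<Rightarrow> (nat \<times> nat) game) \<Rightarrow> (nat \<times> nat) game" where
  "choice_game P n G = Game
    (\<lambda>(m, k) p.
      if m < n then alternate k
      else if m = n \<and> k = 0 then P
      else turn (G (p (n, 0))) (m, if m = n then k - 1 else k) (delete_move n p))
    {x. delete_move n x \<in> payoff (G (x (n, 0)))}"

inductive simple_game ::
  "(nat \<Rightarrow> (nat \<Rightarrow> nat \<Rightarrow> nat) set \<Rightarrow> bool) \<Rightarrow> (nat \<times> nat) game \<Rightarrow> bool"
  for \<Gamma> :: "nat \<Rightarrow> (nat \<Rightarrow> nat \<Rightarrow> nat) set \<Rightarrow> bool" where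
  simple_fixed: "\<Gamma> n A \<Longrightarrow> simple_game \<Gamma> (fixed_game n A)"
| simple_choice_I:
    "(\<And>i. simple_game \<Gamma> (G i)) \<Longrightarrow> simple_game \<Gamma> (choice_game PlayerI n G)"
| simple_choice_II:
    "(\<And>i. simple_game \<Gamma> (G i)) \<Longrightarrow> simple_game \<Gamma> (choice_game PlayerII n G)"

end

theory Submission
  imports Defs "HOL-Library.Countable"
begin

text \<open>For a simple \<open>\<sigma>\<close>-projective game one shows, simultaneously for all \<open>m\<close>, that from every position
  of length \<open>\<omega> \<cdot> m\<close> one of the players wins and that the positions from which Player I wins form a
  \<open>\<sigma>\<close>-projective set.  At a choice these sets are joined or intersected; going back over a block of
  \<open>\<omega>\<close> alternating moves, one applies the determinacy of games of length \<open>\<omega>\<close>, and ``Player I has a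
  winning strategy'' costs one existential and one universal quantifier over \<open>\<omega>\<^sup>\<omega>\<close>.

  Conversely, for every \<open>\<sigma>\<close>-projective set \<open>A \<subseteq> (\<omega>\<^sup>\<omega>)\<^sup>m\<close> there is a simple clopen game in which,
  after \<open>\<omega> \<cdot> m\<close> alternating moves, Player I wins from the positions in \<open>A\<close> and Player II from the
  others: countable unions become choices, and for a projection a player produces the witness with his
  own moves in the next block.  For \<open>m = 1\<close>, a winning strategy in this game, restricted to
  the first \<open>\<omega>\<close> moves, wins the game of length \<open>\<omega>\<close> with payoff \<open>A\<close>.\<close>

section \<open>Games from a given position\<close>

fun opponent :: "player \<Rightarrow> player" where
  "opponent PlayerI = PlayerII"
| "opponent PlayerII = PlayerI"

lemma opponent_opponent [simp]: "opponent (opponent P) = P"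
  by (cases P) auto

fun goal :: "player \<Rightarrow> 'i game \<Rightarrow> ('i \<Rightarrow> nat) set" where
  "goal PlayerI G = payoff G"
| "goal PlayerII G = - payoff G"

lemma goal_opponent: "goal (opponent P) G = - goal P G"
  by (cases P) auto

lemma determined_iff_goal: "determined r G \<longleftrightarrow> (\<exists>P s. \<forall>x. follows r G P s x \<longrightarrow> x \<in> goal P G)"
proof -
  have "(\<exists>P. R P) \<longleftrightarrow> R PlayerI \<or> R PlayerII" for R
    by (metis player.exhaust)
  then show ?thesis
    by (simp add: determined_def)
qed

text \<open>\<open>P\<close> wins \<open>G\<close> when the moves with index in \<open>D\<close> have already been made as in \<open>x\<close>, no matter by
  whom; the values of \<open>x\<close> outside of \<open>D\<close> are irrelevant.\<close>

definition wins :: "player \<Rightarrow> (nat \<times> nat) game \<Rightarrow> (nat \<times> nat) set \<Rightarrow> (nat \<times> nat \<Rightarrow> nat) \<Rightarrow> bool" where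
  "wins P G D x \<longleftrightarrow> (\<exists>s. \<forall>y. (\<forall>j\<in>D. y j = x j) \<longrightarrow>
     (\<forall>j. j \<notin> D \<longrightarrow> turn G j (position omega_sq y j) = P \<longrightarrow> y j = s j (position omega_sq y j)) \<longrightarrow>
     y \<in> goal P G)"

lemma winsI:
  assumes "\<And>y. \<lbrakk>\<And>j. j \<in> D \<Longrightarrow> y j = x j;
      \<And>j. \<lbrakk>j \<notin> D; turn G j (position omega_sq y j) = P\<rbrakk> \<Longrightarrow> y j = s j (position omega_sq y j)\<rbrakk> \<Longrightarrow>
      y \<in> goal P G"
  shows "wins P G D x"
  unfolding wins_def using assms by blast

lemma winsE:
  assumes "wins P G D x"
  obtains s where "\<And>y. \<lbrakk>\<And>j. j \<in> D \<Longrightarrow> y j = x j;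
      \<And>j. \<lbrakk>j \<notin> D; turn G j (position omega_sq y j) = P\<rbrakk> \<Longrightarrow> y j = s j (position omega_sq y j)\<rbrakk> \<Longrightarrow>
      y \<in> goal P G"
  using assms unfolding wins_def by metis

lemma wins_cong: "(\<And>j. j \<in> D \<Longrightarrow> x j = y j) \<Longrightarrow> wins P G D x \<longleftrightarrow> wins P G D y"
  by (simp add: wins_def)

lemma determined_iff_wins: "determined omega_sq G \<longleftrightarrow> (\<exists>P. wins P G {} x)"
  by (auto simp: determined_iff_goal wins_def follows_def)

lemma omega_sq_iff [simp]: "((a, b), (c, d)) \<in> omega_sq \<longleftrightarrow> a < c \<or> a = c \<and> b < d"
  by auto

lemma wf_omega_sq: "wf omega_sq"
  by (simp add: wf_lex_prod)

text \<open>Strategies glue: follow \<open>s\<close> inside the initial segment \<open>E\<close>,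
  then a winning strategy chosen for the position reached on \<open>E\<close>, which all later
  positions still show.\<close>

lemma wins_before:
  assumes "D \<subseteq> E" and down: "\<And>i j. j \<in> E \<Longrightarrow> (i, j) \<in> omega_sq \<Longrightarrow> i \<in> E"
    and win: "\<And>y. \<lbrakk>\<And>j. j \<in> D \<Longrightarrow> y j = x j;
      \<And>j. \<lbrakk>j \<in> E; j \<notin> D; turn G j (position omega_sq y j) = P\<rbrakk> \<Longrightarrow> y j = s j (position omega_sq y j)\<rbrakk> \<Longrightarrow>
      wins P G E y"
  shows "wins P G D x"
proof -
  define good where "good t y \<longleftrightarrow> (\<forall>z. (\<forall>j\<in>E. z j = y j) \<longrightarrow>
     (\<forall>j. j \<notin> E \<longrightarrow> turn G j (position omega_sq z j) = P \<longrightarrow> z j = t j (position omega_sq z j)) \<longrightarrow>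
     z \<in> goal P G)" for t y
  define T where "T y = (SOME t. good t y)" for y
  define s' where "s' j p = (if j \<in> E then s j p else T (restrict p E) j p)" for j p
  show ?thesis
  proof (rule winsI[where s = s'])
    fix y assume yx: "\<And>j. j \<in> D \<Longrightarrow> y j = x j"
      and ys: "\<And>j. \<lbrakk>j \<notin> D; turn G j (position omega_sq y j) = P\<rbrakk> \<Longrightarrow> y j = s' j (position omega_sq y j)"
    have "wins P G E y"
      using yx ys by (intro win) (auto simp: s'_def)
    then have "wins P G E (restrict y E)"
      by (simp cong: wins_cong)
    then have "\<exists>t. good t (restrict y E)"
      by (simp add: wins_def good_def)
    then have "good (T (restrict y E)) (restrict y E)"
      unfolding T_def by (rule someI_ex)
    moreover have "y j = T (restrict y E) j (position omega_sq y j)"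
      if j: "j \<notin> E" "turn G j (position omega_sq y j) = P" for j
    proof -
      \<comment> \<open>The order is linear and \<open>E\<close> is closed downwards, so a move
        outside \<open>E\<close> comes after all of \<open>E\<close> and its position determines
        \<open>restrict y E\<close>.\<close>
      have "(i, j) \<in> omega_sq" if "i \<in> E" for i
      proof -
        have "(i, j) \<in> omega_sq \<or> i = j \<or> (j, i) \<in> omega_sq"
          by (cases i; cases j) auto
        then show ?thesis
          using down[OF that, of j] that j(1) by blast
      qed
      then have "restrict (position omega_sq y j) E = restrict y E"
        by (auto simp: position_def restrict_def fun_eq_iff)
      moreover have "y j = s' j (position omega_sq y j)"
        using ys j \<open>D \<subseteq> E\<close> by blast
      ultimately show ?thesis
        using j by (simp add: s'_def)
    qed
    ultimately show "y \<in> goal P G"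
      unfolding good_def by auto
  qed
qed

text \<open>Playing the two strategies against each other yields one play that lies in both
  goals.\<close>

lemma not_wins_both:
  assumes "wins P G D x" "wins (opponent P) G D x"
  shows False
proof -
  obtain s where s: "\<And>y. \<lbrakk>\<And>j. j \<in> D \<Longrightarrow> y j = x j;
      \<And>j. \<lbrakk>j \<notin> D; turn G j (position omega_sq y j) = P\<rbrakk> \<Longrightarrow> y j = s j (position omega_sq y j)\<rbrakk> \<Longrightarrow>
      y \<in> goal P G"
    using assms(1) by (rule winsE) blast
  obtain t where t: "\<And>y. \<lbrakk>\<And>j. j \<in> D \<Longrightarrow> y j = x j;
      \<And>j. \<lbrakk>j \<notin> D; turn G j (position omega_sq y j) = opponent P\<rbrakk> \<Longrightarrow>
        y j = t j (position omega_sq y j)\<rbrakk> \<Longrightarrow>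
      y \<in> goal (opponent P) G"
    using assms(2) by (rule winsE) blast
  \<comment> \<open>One step of the recursion along \<open>omega_sq\<close>: copy \<open>x\<close>
    on \<open>D\<close>; elsewhere the player to move consults his strategy.\<close>
  define F where "F f j = (let p = position omega_sq f j in
    if j \<in> D then x j else if turn G j p = P then s j p else t j p)" for f j
  define y where "y = wfrec omega_sq F"
  have "adm_wf omega_sq F"
  proof -
    have "position omega_sq f j = position omega_sq g j"
      if "\<And>i. (i, j) \<in> omega_sq \<Longrightarrow> f i = g i" for f g :: "nat \<times> nat \<Rightarrow> nat" and j
      using that by (auto simp: position_def restrict_def fun_eq_iff)
    then show ?thesis
      unfolding adm_wf_def F_def by metis
  qed
  then have y: "y j = F y j" for j
    unfolding y_def by (simp add: wfrec_fixpoint[OF wf_omega_sq, symmetric])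
  have "y \<in> goal P G"
    by (rule s; subst y) (auto simp: F_def Let_def)
  moreover have "y \<in> goal (opponent P) G"
    by (rule t; subst y) (cases P; auto simp: F_def Let_def)+
  ultimately show False
    by (simp add: goal_opponent)
qed

section \<open>Winning from positions of length \<omega> \<cdot> m\<close>

abbreviation before :: "nat \<Rightarrow> (nat \<times> nat) set" where
  "before m \<equiv> {..<m} \<times> UNIV"

definition blocks :: "nat \<Rightarrow> (nat \<times> nat \<Rightarrow> nat) \<Rightarrow> nat \<Rightarrow> nat \<Rightarrow> nat" where
  "blocks m x = (\<lambda>a\<in>{..<m}. \<lambda>b. x (a, b))"

lemma blocks_Suc: "blocks (Suc m) x = (blocks m x)(m := \<lambda>b. x (m, b))"
  by (auto simp: blocks_def fun_eq_iff)

lemma blocks_cong: "(\<And>j. j \<in> before m \<Longrightarrow> x j = y j) \<Longrightarrow> blocks m x = blocks m y"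
  by (auto simp: blocks_def fun_eq_iff)

definition decides :: "player \<Rightarrow> (nat \<times> nat) game \<Rightarrow> nat \<Rightarrow> (nat \<Rightarrow> nat \<Rightarrow> nat) set \<Rightarrow> bool" where
  "decides P G m W \<longleftrightarrow> (\<forall>x. (blocks m x \<in> W \<longrightarrow> wins P G (before m) x) \<and>
     (blocks m x \<notin> W \<longrightarrow> wins (opponent P) G (before m) x))"

definition alternates_below :: "nat \<Rightarrow> (nat \<times> nat) game \<Rightarrow> bool" where
  "alternates_below n G \<longleftrightarrow> (\<forall>a b p. a < n \<longrightarrow> turn G (a, b) p = alternate b)"

lemma alternates_belowD: "alternates_below n G \<Longrightarrow> a < n \<Longrightarrow> turn G (a, b) p = alternate b"
  by (simp add: alternates_below_def)

lemma alternates_below_mono: "alternates_below n G \<Longrightarrow> m \<le> n \<Longrightarrow> alternates_below m G"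
  by (simp add: alternates_below_def)

lemma alternates_below_fixed_game [simp]: "alternates_below m (fixed_game n A)"
  by (simp add: alternates_below_def fixed_game_def)

lemma alternates_below_choice_game [simp]: "alternates_below n (choice_game P n G)"
  by (simp add: alternates_below_def choice_game_def)

lemma follows_omega_iff:
  "follows omega (omega_game A) P s y \<longleftrightarrow>
    (\<forall>k. alternate k = P \<longrightarrow> y k = s k (restrict y {..<k}))"
  by (simp add: follows_def omega_game_def position_def lessThan_def)

text \<open>The form of \<open>wins_before\<close> for one block: \<open>s\<close> sees only the
  earlier moves of block \<open>m\<close>, so it can be a strategy of a game of length
  \<omega>.\<close>

lemma wins_before_block:
  assumes alt: "alternates_below (Suc m) G"
    and win: "\<And>y. \<lbrakk>\<And>j. j \<in> before m \<Longrightarrow> y j = x j;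
      \<And>k. alternate k = P \<Longrightarrow> y (m, k) = s k (restrict (\<lambda>b. y (m, b)) {..<k})\<rbrakk> \<Longrightarrow>
      wins P G (before (Suc m)) y"
  shows "wins P G (before m) x"
proof (rule wins_before[where E = "before (Suc m)"
      and s = "\<lambda>(a, k) p. s k (restrict (\<lambda>b. p (m, b)) {..<k})"])
  fix y assume *: "\<And>j. j \<in> before m \<Longrightarrow> y j = x j"
    "\<And>j. \<lbrakk>j \<in> before (Suc m); j \<notin> before m; turn G j (position omega_sq y j) = P\<rbrakk> \<Longrightarrow>
      y j = (case j of (a, k) \<Rightarrow> \<lambda>p. s k (restrict (\<lambda>b. p (m, b)) {..<k})) (position omega_sq y j)"
  show "wins P G (before (Suc m)) y"
  proof (rule win)
    fix k assume "alternate k = P"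
    then have "y (m, k) = s k (restrict (\<lambda>b. position omega_sq y (m, k) (m, b)) {..<k})"
      using *(2)[of "(m, k)"] alternates_belowD[OF alt] by simp
    also have "restrict (\<lambda>b. position omega_sq y (m, k) (m, b)) {..<k} =
        restrict (\<lambda>b. y (m, b)) {..<k}"
      by (auto simp: position_def fun_eq_iff restrict_def)
    finally show "y (m, k) = s k (restrict (\<lambda>b. y (m, b)) {..<k})" .
  qed (use *(1) in auto)
qed auto

text \<open>The payoff reads only the first \<open>n\<close> blocks, which are complete; from there
  any strategy of the favoured player wins.\<close>

lemma decides_fixed_game:
  assumes "n \<le> m"
  shows "decides PlayerI (fixed_game n A) m {x. restrict x {..<n} \<in> A}"
proof -
  have *: "(\<lambda>a\<in>{..<n}. \<lambda>k. y (a, k)) = restrict (blocks m x) {..<n}"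
    if "\<And>j. j \<in> before m \<Longrightarrow> y j = x j" for x y
  proof -
    have "(\<lambda>a\<in>{..<n}. \<lambda>k. y (a, k)) = restrict (blocks m y) {..<n}"
      using assms by (auto simp: blocks_def fun_eq_iff restrict_def)
    also have "blocks m y = blocks m x"
      using that by (intro blocks_cong) auto
    finally show ?thesis .
  qed
  show ?thesis
    unfolding decides_def by (intro allI conjI impI winsI; drule *; simp add: fixed_game_def)
qed

text \<open>\<open>D\<close> and \<open>E\<close> describe the same position in the choice game and in the chosen game.\<close>

lemma wins_choice_game:
  assumes "(n, 0) \<in> D" "before n \<subseteq> D"
    and E: "\<And>a b. (a, b) \<in> E \<longleftrightarrow> (a, if a = n then Suc b else b) \<in> D"
    and win: "wins Q (G (x (n, 0))) E (delete_move n x)"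
  shows "wins Q (choice_game P n G) D x"
proof -
  let ?G = "G (x (n, 0))"
  obtain s where s: "\<And>z. \<lbrakk>\<And>j. j \<in> E \<Longrightarrow> z j = delete_move n x j;
      \<And>j. \<lbrakk>j \<notin> E; turn ?G j (position omega_sq z j) = Q\<rbrakk> \<Longrightarrow> z j = s j (position omega_sq z j)\<rbrakk> \<Longrightarrow>
      z \<in> goal Q ?G"
    using win by (rule winsE) blast
  \<comment> \<open>In block \<open>n\<close> the choice shifts the later moves by one, so
    \<open>s\<close> is asked about move \<open>b - 1\<close>.\<close>
  define s' where "s' = (\<lambda>(a, b) p. s (a, if a = n then b - 1 else b) (delete_move n p))"
  show ?thesis
  proof (rule winsI[where s = s'])
    fix y assume yx: "\<And>j. j \<in> D \<Longrightarrow> y j = x j"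
      and ys: "\<And>j. \<lbrakk>j \<notin> D; turn (choice_game P n G) j (position omega_sq y j) = Q\<rbrakk> \<Longrightarrow>
        y j = s' j (position omega_sq y j)"
    have y0: "y (n, 0) = x (n, 0)"
      using yx assms(1) by blast
    have "delete_move n y \<in> goal Q ?G"
    proof (rule s)
      fix j assume "j \<in> E"
      then show "delete_move n y j = delete_move n x j"
        using yx by (cases j) (auto simp: delete_move_def E split: if_splits)
    next
      fix j assume j: "j \<notin> E" "turn ?G j (position omega_sq (delete_move n y) j) = Q"
      obtain a b where ab: "j = (a, b)" by (cases j)
      \<comment> \<open>Second index, in the choice game, of the move \<open>j\<close> of the chosen
        game.\<close>
      let ?b = "if a = n then Suc b else b"
      have D: "(a, ?b) \<notin> D"
        using j ab E by blast
      then have "\<not> a < n"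
        using assms(2) by auto
      have pos: "delete_move n (position omega_sq y (a, ?b)) =
          position omega_sq (delete_move n y) (a, b)"
        using \<open>\<not> a < n\<close> by (auto simp: delete_move_def position_def fun_eq_iff restrict_def)
      have p0: "position omega_sq y (a, ?b) (n, 0) = x (n, 0)"
        using \<open>\<not> a < n\<close> D assms(1) y0 by (auto simp: position_def restrict_def)
      have "turn (choice_game P n G) (a, ?b) (position omega_sq y (a, ?b)) = Q"
        using j(2) \<open>\<not> a < n\<close> D assms(1) pos p0
        by (auto simp: choice_game_def ab split: if_splits)
      from ys[OF D this] show "delete_move n y j = s j (position omega_sq (delete_move n y) j)"
        using pos by (auto simp: ab delete_move_def s'_def split: if_splits)
    qed
    then show "y \<in> goal Q (choice_game P n G)"
      by (cases Q) (auto simp: choice_game_def y0)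
  qed
qed

lemma decides_choice_game_after:
  assumes "n < m" "\<And>i. decides Q (G i) m (W i)"
  shows "decides Q (choice_game P n G) m
    {x. x(n := \<lambda>b. x n (Suc b)) \<in> W (x n 0)}"
proof -
  have *: "wins R (choice_game P n G) (before m) x"
    if "wins R (G (x (n, 0))) (before m) (delete_move n x)" for R x
    by (rule wins_choice_game[where E = "before m"]) (use that assms(1) in auto)
  have "(blocks m x)(n := \<lambda>b. blocks m x n (Suc b)) = blocks m (delete_move n x)" for x
    using assms(1) by (auto simp: blocks_def delete_move_def fun_eq_iff)
  moreover have "blocks m x n 0 = x (n, 0)" for x
    using assms(1) by (simp add: blocks_def)
  ultimately show ?thesis
    using assms(2) * unfolding decides_def by simp
qed

text \<open>If \<open>Q\<close> owns the choice, one good \<open>i\<close> suffices; otherwise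
  \<open>Q\<close> must be ready for every \<open>i\<close>.\<close>

lemma wins_choice_game_at:
  assumes "if Q = P then \<exists>i. wins Q (G i) (before n) x else \<forall>i. wins Q (G i) (before n) x"
  shows "wins Q (choice_game P n G) (before n) x"
proof -
  define i where "i = (SOME i. wins Q (G i) (before n) x)"
  have i: "Q = P \<Longrightarrow> wins Q (G i) (before n) x"
    using assms unfolding i_def by (auto intro: someI_ex)
  show ?thesis
  \<comment> \<open>The position just after the choice corresponds to the position
    \<open>before n\<close> of the chosen game.\<close>
  proof (rule wins_before[where E = "insert (n, 0) (before n)" and s = "\<lambda>_ _. i"])
    fix y assume *: "\<And>j. j \<in> before n \<Longrightarrow> y j = x j"
      "\<And>j. \<lbrakk>j \<in> insert (n, 0) (before n); j \<notin> before n;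
        turn (choice_game P n G) j (position omega_sq y j) = Q\<rbrakk> \<Longrightarrow> y j = i"
    have "Q = P \<Longrightarrow> y (n, 0) = i"
      using *(2)[of "(n, 0)"] by (simp add: choice_game_def)
    then have "wins Q (G (y (n, 0))) (before n) x"
      using assms i by (cases "Q = P") auto
    moreover have "delete_move n y j = x j" if "j \<in> before n" for j
      using that *(1) by (auto simp: delete_move_def)
    ultimately have "wins Q (G (y (n, 0))) (before n) (delete_move n y)"
      by (simp cong: wins_cong)
    then show "wins Q (choice_game P n G) (insert (n, 0) (before n)) y"
      by (rule wins_choice_game[rotated 3]) auto
  qed auto
qed

text \<open>For the owner of the choice the quantifier over \<open>i\<close> is existential, for the
  other player universal; complements exchange the two.\<close>

lemma decides_choice_game_at:
  assumes "\<And>i. decides Q (G i) n (W i)"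
  shows "decides Q (choice_game P n G) n (if Q = P then \<Union>i. W i else \<Inter>i. W i)"
proof -
  have "opponent Q = P \<longleftrightarrow> Q \<noteq> P"
    by (cases P; cases Q) auto
  then show ?thesis
    using assms unfolding decides_def
    by (intro allI conjI impI wins_choice_game_at) (auto split: if_splits)
qed

lemma decides_opponent: "decides (opponent P) G m W \<longleftrightarrow> decides P G m (- W)"
  by (auto simp: decides_def)

lemma decides_cong:
  assumes "\<And>x. x \<in> extensional {..<m} \<Longrightarrow> x \<in> V \<longleftrightarrow> x \<in> W"
  shows "decides P G m V \<longleftrightarrow> decides P G m W"
proof -
  have "blocks m x \<in> V \<longleftrightarrow> blocks m x \<in> W" for x
    by (rule assms) (simp add: blocks_def)
  then show ?thesis
    by (simp add: decides_def)
qed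

section \<open>Determinacy read off from decided positions\<close>

lemma determined_if_decides:
  assumes "decides P G 0 W"
  shows "determined omega_sq G"
  using assms unfolding decides_def determined_iff_wins[of _ undefined] by auto

text \<open>\<open>Q\<close> follows the first block of his winning strategy in \<open>G\<close>. If
  the result favoured the opponent, the opponent would win \<open>G\<close> from there, yet
  \<open>Q\<close> wins by continuing his strategy.\<close>

lemma determined_omega_game_if_decides:
  assumes det: "determined omega_sq G" and alt: "alternates_below 1 G"
    and dec: "decides PlayerI G 1 A"
  shows "determined omega (omega_game A)"
proof -
  obtain Q s where s: "\<And>x. follows omega_sq G Q s x \<Longrightarrow> x \<in> goal Q G"
    using det by (auto simp: determined_iff_goal)
  \<comment> \<open>\<open>p\<close> is copied into every block to get a function on pairs; the
    position at \<open>(0, k)\<close> keeps only the part in block 0.\<close>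
  define s' where "s' k p = s (0, k) (position omega_sq (\<lambda>(a, b). p b) (0, k))" for k p
  have "y \<in> goal Q (omega_game A)" if y: "follows omega (omega_game A) Q s' y" for y
  proof -
    define x :: "nat \<times> nat \<Rightarrow> nat" where "x = (\<lambda>(a, b). y b)"
    have "wins Q G (before 1) x"
    proof (rule winsI[where s = s])
      fix z assume z: "\<And>j. j \<in> before 1 \<Longrightarrow> z j = x j"
        "\<And>j. \<lbrakk>j \<notin> before 1; turn G j (position omega_sq z j) = Q\<rbrakk> \<Longrightarrow>
          z j = s j (position omega_sq z j)"
      show "z \<in> goal Q G"
      proof (rule s)
        have "z (a, b) = s (a, b) (position omega_sq z (a, b))"
          if turn: "turn G (a, b) (position omega_sq z (a, b)) = Q" for a b
        proof (cases "a = 0")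
          case True
          have "alternate b = Q"
            using turn True alternates_belowD[OF alt] by simp
          then have "z (0, b) = s' b (restrict y {..<b})"
            using y z(1)[of "(0, b)"] by (simp add: follows_omega_iff x_def)
          moreover have "position omega_sq (\<lambda>(a, c). restrict y {..<b} c) (0, b) =
              position omega_sq z (0, b)"
            using z(1) by (auto simp: position_def fun_eq_iff restrict_def x_def)
          ultimately show ?thesis
            by (simp add: s'_def True)
        next
          case False
          then show ?thesis
            using z(2) turn by simp
        qed
        then show "follows omega_sq G Q s z"
          by (auto simp: follows_def)
      qed
    qed
    then have "\<not> wins (opponent Q) G (before 1) x"
      using not_wins_both by blast
    moreover have "blocks 1 x = (\<lambda>_\<in>{..<1}. y)"
      by (auto simp: blocks_def x_def fun_eq_iff)
    ultimately show ?thesis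
      using dec unfolding decides_def by (cases Q) (auto simp: omega_game_def)
  qed
  then show ?thesis
    unfolding determined_iff_goal by blast
qed

section \<open>Continuous maps and \<open>\<sigma>\<close>-projective sets\<close>

abbreviation continuous_discrete :: "'a topology \<Rightarrow> ('a \<Rightarrow> 'b) \<Rightarrow> bool" where
  "continuous_discrete X f \<equiv> continuous_map X (discrete_topology UNIV) f"

text \<open>The preimage of an open set is cut up by the value of \<open>g\<close>; each piece is
  open because \<open>g\<close> maps into a discrete space.\<close>

lemma continuous_map_discrete_parameter:
  assumes g: "continuous_discrete X g"
    and h: "\<And>b. continuous_map X Y (h b)"
  shows "continuous_map X Y (\<lambda>x. h (g x) x)"
  unfolding continuous_map_def
proof (intro conjI allI impI)
  show "(\<lambda>x. h (g x) x) \<in> topspace X \<rightarrow> topspace Y"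
    using h by (auto simp: continuous_map_def)
  fix U assume U: "openin Y U"
  have *: "openin X ({x \<in> topspace X. g x \<in> {b}} \<inter> {x \<in> topspace X. h b x \<in> U})" for b
    by (intro openin_Int openin_continuous_map_preimage[OF g] openin_continuous_map_preimage[OF h U])
      simp
  have "{x \<in> topspace X. h (g x) x \<in> U} =
      (\<Union>b. {x \<in> topspace X. g x \<in> {b}} \<inter> {x \<in> topspace X. h b x \<in> U})"
    by auto
  also have "openin X \<dots>"
    using * by blast
  finally show "openin X {x \<in> topspace X. h (g x) x \<in> U}" .
qed

lemma continuous_discrete_compose:
  "continuous_discrete X f \<Longrightarrow> continuous_discrete X (\<lambda>x. h (f x))"
  by (rule continuous_map_discrete_parameter[where h = "\<lambda>b _. h b"]) auto

lemma continuous_discrete_compose2: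
  assumes f: "continuous_discrete X f" and g: "continuous_discrete X g"
  shows "continuous_discrete X (\<lambda>x. h (f x) (g x))"
  by (rule continuous_map_discrete_parameter[OF f, of _ "\<lambda>b x. h b (g x)"])
    (rule continuous_discrete_compose[OF g])

lemma topspace_baire [simp]: "topspace baire = UNIV"
  by (simp add: baire_def)

lemma topspace_baire_pow [simp]: "topspace (baire_pow k) = extensional {..<k}"
  by (simp add: baire_pow_def PiE_def Pi_def)

lemma continuous_map_baire_powI:
  assumes "\<And>x. x \<in> topspace X \<Longrightarrow> f x \<in> extensional {..<k}"
    and "\<And>a b. a < k \<Longrightarrow> continuous_discrete X (\<lambda>x. f x a b)"
  shows "continuous_map X (baire_pow k) f"
  using assms
  by (auto simp: baire_pow_def baire_def continuous_map_componentwise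
      continuous_map_componentwise_UNIV)

lemma continuous_baire_powD:
  assumes "continuous_map X (baire_pow k) f" "a < k"
  shows "continuous_discrete X (\<lambda>x. f x a b)"
  using assms
  by (auto simp: baire_pow_def baire_def continuous_map_componentwise
      continuous_map_componentwise_UNIV)

lemma continuous_coordinate:
  "a < k \<Longrightarrow> continuous_discrete (baire_pow k) (\<lambda>x. x a b)"
  by (rule continuous_baire_powD[where f = "\<lambda>x. x"]) auto

lemma continuous_map_restrict:
  assumes "m \<le> k"
  shows "continuous_map (baire_pow k) (baire_pow m) (\<lambda>x. restrict x {..<m})"
  by (rule continuous_map_baire_powI) (use assms continuous_coordinate in auto)

lemma extensional_upd [simp]:
  "x \<in> extensional {..<m} \<Longrightarrow> x(m := v) \<in> extensional {..<Suc m}"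
  by (auto simp: extensional_def)

lemma continuous_map_upd:
  assumes f: "continuous_map X (baire_pow m) f"
    and h: "\<And>b. continuous_discrete X (\<lambda>x. h x b)"
  shows "continuous_map X (baire_pow (Suc m)) (\<lambda>x. (f x)(m := h x))"
proof (rule continuous_map_baire_powI)
  show "(f x)(m := h x) \<in> extensional {..<Suc m}" if "x \<in> topspace X" for x
    using continuous_map_funspace[OF f] that by (intro extensional_upd) (simp add: Pi_iff)
  show "continuous_discrete X (\<lambda>x. ((f x)(m := h x)) a b)" if "a < Suc m" for a b
    using that h continuous_baire_powD[OF f] by (cases "a = m") auto
qed

section \<open>Clopen sets and a countable base\<close>

lemma clopen_preimage_discrete:
  assumes "continuous_discrete (baire_pow k) f"
  shows "clopen k {x \<in> topspace (baire_pow k). f x \<in> S}"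
  unfolding clopen_def
  using openin_continuous_map_preimage[OF assms, of S]
    closedin_continuous_map_preimage[OF assms, of S] by simp

lemma clopen_Compl:
  "clopen k A \<Longrightarrow> clopen k (topspace (baire_pow k) - A)"
  unfolding clopen_def by (metis closedin_topspace closedin_diff openin_diff openin_topspace)

text \<open>Names of basic neighbourhoods. They form a countable type, and continuity into the
  discrete space of names makes the neighbourhoods clopen.\<close>

definition initial :: "nat \<Rightarrow> nat \<Rightarrow> (nat \<Rightarrow> nat \<Rightarrow> nat) \<Rightarrow> nat list list" where
  "initial k n x = map (\<lambda>a. map (x a) [0..<n]) [0..<k]"

lemma initial_eq_iff: "initial k n x = initial k n y \<longleftrightarrow> (\<forall>a<k. \<forall>b<n. x a b = y a b)"
  by (auto simp: initial_def)

lemma continuous_discrete_map: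
  assumes "\<And>a. a \<in> set xs \<Longrightarrow> continuous_discrete X (\<lambda>x. f x a)"
  shows "continuous_discrete X (\<lambda>x. map (f x) xs)"
  using assms by (induction xs) (auto intro: continuous_discrete_compose2)

lemma continuous_initial: "continuous_discrete (baire_pow k) (initial k n)"
  unfolding initial_def
  by (intro continuous_discrete_map) (simp add: continuous_coordinate)

text \<open>The sets that contain with each point a basic neighbourhood form a topology in which the
  coordinate functions are continuous.\<close>

lemma openin_baire_pow_initial:
  assumes U: "openin (baire_pow k) U" and x: "x \<in> U"
  shows "\<exists>n. \<forall>y\<in>extensional {..<k}. initial k n y = initial k n x \<longrightarrow> y \<in> U"
proof -
  define good where "good U \<longleftrightarrow> U \<subseteq> extensional {..<k} \<and>
    (\<forall>x\<in>U. \<exists>n. \<forall>y\<in>extensional {..<k}. initial k n y = initial k n x \<longrightarrow> y \<in> U)" for U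
  have "istopology good"
    unfolding istopology_def
  proof (intro conjI allI impI)
    fix S T assume ST: "good S" "good T"
    show "good (S \<inter> T)"
      unfolding good_def
    proof (intro conjI ballI)
      fix z assume "z \<in> S \<inter> T"
      then obtain m n where
        "\<forall>y\<in>extensional {..<k}. initial k m y = initial k m z \<longrightarrow> y \<in> S"
        "\<forall>y\<in>extensional {..<k}. initial k n y = initial k n z \<longrightarrow> y \<in> T"
        using ST unfolding good_def by blast
      then show "\<exists>n. \<forall>y\<in>extensional {..<k}. initial k n y = initial k n z \<longrightarrow> y \<in> S \<inter> T"
        by (intro exI[of _ "max m n"]) (auto simp: initial_eq_iff)
    qed (use ST in \<open>auto simp: good_def\<close>)
  next
    fix \<K> assume "\<forall>K\<in>\<K>. good K"
    then show "good (\<Union>\<K>)"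
      unfolding good_def by (meson Sup_least UnionE UnionI)
  qed
  then have openin: "openin (topology good) S \<longleftrightarrow> good S" for S
    by simp
  have "good (extensional {..<k})"
    by (auto simp: good_def)
  then have top: "topspace (topology good) = extensional {..<k}"
    by (auto simp: topspace_def openin good_def)
  have "continuous_map (topology good) (baire_pow k) (\<lambda>x. x)"
  proof (rule continuous_map_baire_powI)
    fix a b assume "a < k"
    have "good {x \<in> extensional {..<k}. x a b \<in> S}" for S
      unfolding good_def
      \<comment> \<open>Length \<open>Suc b\<close> is the least at which an initial segment shows
        the entry \<open>x a b\<close>.\<close>
      by (auto intro!: exI[of _ "Suc b"] simp: initial_eq_iff \<open>a < k\<close>)
    then show "continuous_discrete (topology good) (\<lambda>x. x a b)"
      by (simp add: continuous_map_def openin top)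
  qed (simp add: top)
  from openin_continuous_map_preimage[OF this U] have "good {x \<in> extensional {..<k}. x \<in> U}"
    by (simp add: openin top)
  moreover have "{x \<in> extensional {..<k}. x \<in> U} = U"
    using openin_subset[OF U] by auto
  ultimately have "good U"
    by (simp only:)
  then show ?thesis
    using x by (simp add: good_def)
qed

text \<open>Enumerate all pairs of a length and a name, and keep the clopen neighbourhoods that lie
  inside \<open>U\<close>.\<close>

lemma openin_baire_pow_imp_Union_clopen:
  assumes U: "openin (baire_pow k) U"
  obtains C :: "nat \<Rightarrow> _" where "\<And>i. clopen k (C i)" "U = (\<Union>i. C i)"
proof
  define B where "B = (\<lambda>(n, l). {x \<in> topspace (baire_pow k). initial k n x \<in> {l}})"
  define C where "C i = (if B (from_nat i) \<subseteq> U then B (from_nat i) else {})" for i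
  have "clopen k (B p)" for p
    unfolding B_def by (cases p) (simp only: case_prod_conv clopen_preimage_discrete[OF continuous_initial])
  moreover have "clopen k {}"
    by (simp add: clopen_def)
  ultimately show "clopen k (C i)" for i
    unfolding C_def by simp
  show "U = (\<Union>i. C i)"
  proof
    show "U \<subseteq> (\<Union>i. C i)"
    proof
      fix x assume "x \<in> U"
      then obtain n where "\<forall>y\<in>extensional {..<k}. initial k n y = initial k n x \<longrightarrow> y \<in> U"
        using openin_baire_pow_initial[OF U] by blast
      moreover have "x \<in> extensional {..<k}"
        using openin_subset[OF U] \<open>x \<in> U\<close> by auto
      ultimately have "x \<in> C (to_nat (n, initial k n x))"
        by (auto simp: C_def B_def)
      then show "x \<in> (\<Union>i. C i)"
        by blast
    qed
  qed (auto simp: C_def)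
qed

section \<open>Closure properties of \<sigma>-projective sets\<close>

lemma sigma_projective_subset: "sigma_projective k A \<Longrightarrow> A \<subseteq> topspace (baire_pow k)"
proof (induction rule: sigma_projective.induct)
  case (sp_open k A)
  then show ?case
    by (intro openin_subset)
qed auto

lemma sigma_projective_pos: "sigma_projective k A \<Longrightarrow> k \<ge> 1"
  by (induction rule: sigma_projective.induct)

lemma sigma_projective_Inter:
  assumes "\<And>i::nat. sigma_projective k (A i)"
  shows "sigma_projective k (\<Inter>i. A i)"
proof -
  have *: "(\<Inter>i. A i) = topspace (baire_pow k) - (\<Union>i. topspace (baire_pow k) - A i)"
    using sigma_projective_subset[OF assms] by auto
  show ?thesis
    by (subst *) (intro sp_compl sp_Union assms)
qed

lemma sigma_projective_Int:
  assumes "sigma_projective k A" "sigma_projective k B"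
  shows "sigma_projective k (A \<inter> B)"
proof -
  have "A \<inter> B = (\<Inter>i::nat. if i = 0 then A else B)"
    by (auto split: if_splits)
  then show ?thesis
    using sigma_projective_Inter[of k "\<lambda>i. if i = 0 then A else B"] assms by simp
qed

lemma extensional_Suc_eq_upd:
  "z \<in> extensional {..<Suc k} \<Longrightarrow> (restrict z {..<k})(k := z k) = z"
  by (auto simp: fun_eq_iff extensional_def restrict_def)

lemma restrict_upd_eq:
  fixes k :: nat
  shows "x \<in> extensional {..<k} \<Longrightarrow> restrict (x(k := v)) {..<k} = x"
  by (rule extensionalityI[of _ "{..<k}"]) auto

lemma image_restrict_eq_ex_upd:
  assumes "A \<subseteq> extensional {..<Suc k}"
  shows "(\<lambda>x. restrict x {..<k}) ` A = {x \<in> extensional {..<k}. \<exists>v. x(k := v) \<in> A}"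
proof (intro equalityI subsetI)
  fix x assume "x \<in> (\<lambda>x. restrict x {..<k}) ` A"
  then obtain z where z: "z \<in> A" "x = restrict z {..<k}"
    by auto
  have "z \<in> extensional {..<Suc k}"
    using assms z(1) by blast
  then have "x(k := z k) \<in> A"
    by (simp only: z extensional_Suc_eq_upd)
  moreover have "x \<in> extensional {..<k}"
    using z(2) by simp
  ultimately show "x \<in> {x \<in> extensional {..<k}. \<exists>v. x(k := v) \<in> A}"
    by blast
next
  fix x assume "x \<in> {x \<in> extensional {..<k}. \<exists>v. x(k := v) \<in> A}"
  then obtain v where "x \<in> extensional {..<k}" "x(k := v) \<in> A"
    by blast
  then show "x \<in> (\<lambda>x. restrict x {..<k}) ` A"
    by (intro image_eqI[of _ _ "x(k := v)"]) (simp_all add: restrict_upd_eq extensional_restrict)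
qed

lemma sigma_projective_Ex:
  assumes "sigma_projective (Suc k) A" "k \<ge> 1"
  shows "sigma_projective k {x \<in> extensional {..<k}. \<exists>v. x(k := v) \<in> A}"
  using sp_proj[OF assms(2,1)] sigma_projective_subset[OF assms(1)]
  by (simp add: image_restrict_eq_ex_upd)

lemma sigma_projective_All:
  assumes "sigma_projective (Suc k) A" "k \<ge> 1"
  shows "sigma_projective k {x \<in> extensional {..<k}. \<forall>v. x(k := v) \<in> A}"
proof -
  have "{x \<in> extensional {..<k}. \<forall>v. x(k := v) \<in> A} = topspace (baire_pow k) -
      {x \<in> extensional {..<k}. \<exists>v. x(k := v) \<in> topspace (baire_pow (Suc k)) - A}"
    by auto
  then show ?thesis
    using sp_compl[OF sigma_projective_Ex[OF sp_compl[OF assms(1)] assms(2)]] by simp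
qed

text \<open>Induction on the construction of \<open>A\<close>, for all \<open>f\<close> at once: for
  a projection, the witness becomes an extra coordinate of the domain.\<close>

lemma sigma_projective_preimage:
  assumes "sigma_projective k A" "continuous_map (baire_pow j) (baire_pow k) f" "j \<ge> 1"
  shows "sigma_projective j {x \<in> extensional {..<j}. f x \<in> A}"
  using assms
proof (induction arbitrary: j f rule: sigma_projective.induct)
  case (sp_open k A)
  then show ?case
    using openin_continuous_map_preimage[of "baire_pow j" "baire_pow k" f A]
    by (auto intro: sigma_projective.sp_open)
next
  case (sp_compl k A)
  have "{x \<in> extensional {..<j}. f x \<in> topspace (baire_pow k) - A} =
      topspace (baire_pow j) - {x \<in> extensional {..<j}. f x \<in> A}"
    using continuous_map_funspace[OF sp_compl.prems(1)] by auto
  then show ?case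
    using sigma_projective.sp_compl[OF sp_compl.IH[OF sp_compl.prems]] by simp
next
  case (sp_Union k A)
  have "{x \<in> extensional {..<j}. f x \<in> (\<Union>i. A i)} = (\<Union>i. {x \<in> extensional {..<j}. f x \<in> A i})"
    by auto
  then show ?case
    using sigma_projective.sp_Union[OF sp_Union.IH[OF sp_Union.prems]] by simp
next
  case (sp_proj k A)
  \<comment> \<open>\<open>g\<close> applies \<open>f\<close> to the first \<open>j\<close>
    coordinates and passes the last one on as coordinate \<open>k\<close>.\<close>
  define g where "g z = (f (restrict z {..<j}))(k := z j)" for z
  have "continuous_map (baire_pow (Suc j)) (baire_pow k) (\<lambda>z. f (restrict z {..<j}))"
    using continuous_map_compose[OF continuous_map_restrict sp_proj.prems(1), of "Suc j"]
    by (simp add: o_def)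
  then have "continuous_map (baire_pow (Suc j)) (baire_pow (Suc k)) g"
    unfolding g_def by (rule continuous_map_upd) (simp add: continuous_coordinate)
  from sp_proj.IH[OF this]
  have "sigma_projective j {x \<in> extensional {..<j}.
      \<exists>v. x(j := v) \<in> {x \<in> extensional {..<Suc j}. g x \<in> A}}"
    using sp_proj.prems(2) by (intro sigma_projective_Ex) auto
  also have "{x \<in> extensional {..<j}. \<exists>v. x(j := v) \<in> {x \<in> extensional {..<Suc j}. g x \<in> A}} =
      {x \<in> extensional {..<j}. f x \<in> (\<lambda>x. restrict x {..<k}) ` A}"
  proof (rule Collect_cong, rule conj_cong[OF refl])
    fix x :: "nat \<Rightarrow> nat \<Rightarrow> nat" assume x: "x \<in> extensional {..<j}"
    have "g (x(j := v)) = (f x)(k := v)" for v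
      by (simp add: g_def restrict_upd_eq[OF x])
    moreover have "f x \<in> extensional {..<k}"
      using continuous_map_funspace[OF sp_proj.prems(1)] x by (simp add: Pi_iff)
    moreover have "A \<subseteq> extensional {..<Suc k}"
      using sigma_projective_subset[OF sp_proj.hyps(2)] by (simp only: topspace_baire_pow)
    ultimately show "(\<exists>v. x(j := v) \<in> {x \<in> extensional {..<Suc j}. g x \<in> A}) \<longleftrightarrow>
        f x \<in> (\<lambda>x. restrict x {..<k}) ` A"
      using extensional_upd[OF x] by (simp only: image_restrict_eq_ex_upd mem_Collect_eq simp_thms)
  qed
  finally show ?case .
qed

section \<open>From games of length \<open>\<omega>\<close> to simple games\<close>

text \<open>Here \<open>\<sigma>\<close> codes a strategy of Player I and \<open>\<tau>\<close> supplies the moves of Player II; the values of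
  \<open>\<tau>\<close> at even numbers do not matter.\<close>

fun play_prefix :: "(nat \<Rightarrow> nat) \<Rightarrow> (nat \<Rightarrow> nat) \<Rightarrow> nat \<Rightarrow> nat list" where
  "play_prefix \<sigma> \<tau> 0 = []"
| "play_prefix \<sigma> \<tau> (Suc k) = play_prefix \<sigma> \<tau> k @
    [if alternate k = PlayerI then \<sigma> (to_nat (play_prefix \<sigma> \<tau> k)) else \<tau> k]"

definition play :: "(nat \<Rightarrow> nat) \<Rightarrow> (nat \<Rightarrow> nat) \<Rightarrow> nat \<Rightarrow> nat" where
  "play \<sigma> \<tau> k = (if alternate k = PlayerI then \<sigma> (to_nat (play_prefix \<sigma> \<tau> k)) else \<tau> k)"

lemma play_prefix_eq_map: "play_prefix \<sigma> \<tau> k = map (play \<sigma> \<tau>) [0..<k]"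
  by (induction k) (simp_all add: play_def)

lemma play_I: "alternate k = PlayerI \<Longrightarrow> play \<sigma> \<tau> k = \<sigma> (to_nat (map (play \<sigma> \<tau>) [0..<k]))"
  by (simp add: play_def play_prefix_eq_map)

text \<open>A play obeying \<open>\<sigma>\<close> is regenerated from \<open>\<sigma>\<close> when
  the play itself supplies the moves of Player II.\<close>

lemma eq_play:
  assumes "\<And>k. alternate k = PlayerI \<Longrightarrow> y k = \<sigma> (to_nat (map y [0..<k]))"
  shows "y = play \<sigma> y"
proof
  fix k show "y k = play \<sigma> y k"
  proof (induction k rule: less_induct)
    case (less k)
    then have "map y [0..<k] = map (play \<sigma> y) [0..<k]"
      by simp
    then show ?case
      using assms[of k] play_I[of k \<sigma> y]
      by (cases "alternate k = PlayerI") (simp_all only:, simp add: play_def)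
  qed
qed

text \<open>Induction on the prefix: it takes values in a discrete space, so \<open>\<sigma>\<close>
  may be evaluated at its varying code.\<close>

lemma continuous_play:
  assumes "\<And>b. continuous_discrete X (\<lambda>x. \<sigma> x b)" "\<And>b. continuous_discrete X (\<lambda>x. \<tau> x b)"
  shows "continuous_discrete X (\<lambda>x. play (\<sigma> x) (\<tau> x) k)"
proof -
  have move: "continuous_discrete X (\<lambda>x. play (\<sigma> x) (\<tau> x) k)"
    if "continuous_discrete X (\<lambda>x. play_prefix (\<sigma> x) (\<tau> x) k)" for k
    unfolding play_def
    by (cases "alternate k = PlayerI")
      (simp_all add: assms continuous_map_discrete_parameter[OF that, of _ "\<lambda>l x. \<sigma> x (to_nat l)"])
  have "continuous_discrete X (\<lambda>x. play_prefix (\<sigma> x) (\<tau> x) k)" for k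
  proof (induction k)
    case (Suc k)
    have "continuous_discrete X (\<lambda>x. play_prefix (\<sigma> x) (\<tau> x) k @ [play (\<sigma> x) (\<tau> x) k])"
      by (rule continuous_discrete_compose2[OF Suc move[OF Suc]])
    then show ?case
      by (simp add: play_def)
  qed simp
  then show ?thesis
    by (rule move)
qed

text \<open>Positions are finite sequences, hence coded by numbers; so a strategy of Player I
  becomes a point of Baire space that can be quantified over.\<close>

lemma wins_I_omega_game_iff:
  "(\<exists>s. \<forall>y. follows omega (omega_game A) PlayerI s y \<longrightarrow> R y) \<longleftrightarrow> (\<exists>\<sigma>. \<forall>\<tau>. R (play \<sigma> \<tau>))"
proof
  assume "\<exists>s. \<forall>y. follows omega (omega_game A) PlayerI s y \<longrightarrow> R y"
  then obtain s where s: "\<And>y. follows omega (omega_game A) PlayerI s y \<Longrightarrow> R y"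
    by blast
  \<comment> \<open>\<open>s\<close> expects a restricted function, so the decoded list is turned
    back into one.\<close>
  define \<sigma> where "\<sigma> c = (let l = from_nat c in s (length l) (\<lambda>i\<in>{..<length l}. l ! i))" for c
  have "follows omega (omega_game A) PlayerI s (play \<sigma> \<tau>)" for \<tau>
  proof -
    have "(\<lambda>i\<in>{..<k}. map (play \<sigma> \<tau>) [0..<k] ! i) = restrict (play \<sigma> \<tau>) {..<k}" for k
      by auto
    then show ?thesis
      by (simp add: follows_omega_iff play_I) (simp add: \<sigma>_def)
  qed
  then show "\<exists>\<sigma>. \<forall>\<tau>. R (play \<sigma> \<tau>)"
    using s by blast
next
  assume "\<exists>\<sigma>. \<forall>\<tau>. R (play \<sigma> \<tau>)"
  then obtain \<sigma> where \<sigma>: "\<And>\<tau>. R (play \<sigma> \<tau>)"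
    by blast
  have "R y" if y: "follows omega (omega_game A) PlayerI (\<lambda>k p. \<sigma> (to_nat (map p [0..<k]))) y" for y
  proof -
    have *: "map (restrict y {..<k}) [0..<k] = map y [0..<k]" for k
      by simp
    have "y = play \<sigma> y"
      using y unfolding follows_omega_iff * by (intro eq_play) blast
    then show ?thesis
      using \<sigma> by metis
  qed
  then show "\<exists>s. \<forall>y. follows omega (omega_game A) PlayerI s y \<longrightarrow> R y"
    by blast
qed

section \<open>Winning positions in simple \<sigma>-projective games\<close>

text \<open>The guard \<open>m \<ge> 1\<close> is there because \<open>sigma_projective\<close>
  holds only in positive dimension; at \<open>m = 0\<close> determinacy remains.\<close>

definition sp_decided :: "(nat \<times> nat) game \<Rightarrow> nat \<Rightarrow> bool" where
  "sp_decided G m \<longleftrightarrow> (\<exists>W. (m \<ge> 1 \<longrightarrow> sigma_projective m W) \<and> decides PlayerI G m W)"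

lemma blocks_extensional [simp]: "blocks m x \<in> extensional {..<m}"
  by (simp add: blocks_def)

lemma wins_before_block_blocks:
  assumes "alternates_below (Suc m) G"
    and "\<And>z. follows omega (omega_game A) P s z \<Longrightarrow> (blocks m x)(m := z) \<in> V"
    and "\<And>y. blocks (Suc m) y \<in> V \<Longrightarrow> wins P G (before (Suc m)) y"
  shows "wins P G (before m) x"
proof (rule wins_before_block[OF assms(1)])
  fix y assume y: "\<And>j. j \<in> before m \<Longrightarrow> y j = x j"
    "\<And>k. alternate k = P \<Longrightarrow> y (m, k) = s k (restrict (\<lambda>b. y (m, b)) {..<k})"
  have "(blocks m x)(m := \<lambda>b. y (m, b)) \<in> V"
    by (rule assms(2)) (simp add: follows_omega_iff y(2))
  moreover have "blocks m y = blocks m x"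
    by (rule blocks_cong) (rule y(1))
  ultimately show "wins P G (before (Suc m)) y"
    by (intro assms(3)) (simp add: blocks_Suc)
qed

text \<open>Block \<open>m\<close> is a game of length \<omega> whose payoff is the section of
  \<open>V\<close> at the given position; its determinacy decides that position.\<close>

lemma sp_decided_before:
  assumes det: "\<forall>A. sigma_projective 1 A \<longrightarrow> determined omega (omega_game A)"
    and alt: "alternates_below (Suc m) G" and dec: "sp_decided G (Suc m)"
  shows "sp_decided G m"
proof -
  obtain V where V: "sigma_projective (Suc m) V" "decides PlayerI G (Suc m) V"
    using dec by (auto simp: sp_decided_def)
  define W where "W = {x \<in> extensional {..<m}. \<exists>\<sigma>. \<forall>\<tau>. x(m := play \<sigma> \<tau>) \<in> V}"
  have "decides PlayerI G m W"
    unfolding decides_def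
  proof (intro allI conjI impI)
    fix x assume "blocks m x \<in> W"
    then have "\<exists>\<sigma>. \<forall>\<tau>. (blocks m x)(m := play \<sigma> \<tau>) \<in> V"
      by (simp add: W_def)
    \<comment> \<open>\<open>follows\<close> looks only at turns and positions, which are the same
      for every payoff; hence the placeholder \<open>undefined\<close>.\<close>
    then have "\<exists>s. \<forall>z. follows omega (omega_game undefined) PlayerI s z \<longrightarrow>
        (blocks m x)(m := z) \<in> V"
      by (simp only: wins_I_omega_game_iff)
    then obtain s where
      "\<forall>z. follows omega (omega_game undefined) PlayerI s z \<longrightarrow> (blocks m x)(m := z) \<in> V"
      by blast
    then show "wins PlayerI G (before m) x"
      using V(2) by (intro wins_before_block_blocks[OF alt, where V = V]) (auto simp: decides_def)
  next
    fix x assume notin: "blocks m x \<notin> W"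
    \<comment> \<open>The section of \<open>V\<close> over the fixed first \<open>m\<close> blocks,
      as a subset of the one-dimensional space.\<close>
    define A where "A = {u \<in> extensional {..<1::nat}. (blocks m x)(m := u 0) \<in> V}"
    have "continuous_map (baire_pow 1) (baire_pow (Suc m)) (\<lambda>u. (blocks m x)(m := u 0))"
      by (rule continuous_map_upd) (simp_all add: continuous_coordinate)
    then have "sigma_projective 1 A"
      unfolding A_def by (rule sigma_projective_preimage[OF V(1)]) simp
    then have "determined omega (omega_game A)"
      using det by blast
    moreover have payoff: "payoff (omega_game A) = {z. (blocks m x)(m := z) \<in> V}"
      by (simp add: omega_game_def A_def)
    have "\<not> (\<exists>s. \<forall>y. follows omega (omega_game A) PlayerI s y \<longrightarrow> y \<in> payoff (omega_game A))"
      using notin by (simp add: wins_I_omega_game_iff payoff W_def)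
    ultimately obtain s where
      "\<forall>z. follows omega (omega_game A) PlayerII s z \<longrightarrow> (blocks m x)(m := z) \<in> - V"
      unfolding determined_def payoff by auto
    then show "wins (opponent PlayerI) G (before m) x"
      using V(2) by (intro wins_before_block_blocks[OF alt, where V = "- V"]) (auto simp: decides_def)
  qed
  moreover have "sigma_projective m W" if "m \<ge> 1"
  proof -
    \<comment> \<open>Coordinates \<open>m\<close> and \<open>Suc m\<close> hold
      \<open>\<sigma>\<close> and \<open>\<tau>\<close>; \<open>f\<close> replaces them by the
      resulting play, so \<open>W\<close> is an \<exists>\<forall> projection of a preimage of
      \<open>V\<close>.\<close>
    define f where "f z = (restrict z {..<m})(m := play (z m) (z (Suc m)))" for z
    have "continuous_map (baire_pow (Suc (Suc m))) (baire_pow (Suc m)) f"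
      unfolding f_def
      by (intro continuous_map_upd continuous_map_restrict continuous_play)
        (simp_all add: continuous_coordinate)
    then have "sigma_projective (Suc (Suc m)) {z \<in> extensional {..<Suc (Suc m)}. f z \<in> V}"
      by (intro sigma_projective_preimage[OF V(1)]) simp_all
    then have "sigma_projective m {x \<in> extensional {..<m}. \<exists>\<sigma>.
        x(m := \<sigma>) \<in> {x \<in> extensional {..<Suc m}. \<forall>\<tau>.
          x(Suc m := \<tau>) \<in> {z \<in> extensional {..<Suc (Suc m)}. f z \<in> V}}}"
      using that by (intro sigma_projective_Ex sigma_projective_All) simp_all
    moreover have "f (x(m := \<sigma>, Suc m := \<tau>)) = x(m := play \<sigma> \<tau>)"
      if "x \<in> extensional {..<m}" for x \<sigma> \<tau>
    proof -
      have "restrict (x(m := \<sigma>, Suc m := \<tau>)) {..<m} = x"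
        using that by (auto simp: fun_eq_iff extensional_def restrict_def)
      then show ?thesis
        by (simp add: f_def)
    qed
    ultimately show ?thesis
      unfolding W_def by (simp del: lessThan_Suc cong: conj_cong)
  qed
  ultimately show ?thesis
    unfolding sp_decided_def by blast
qed

lemma sp_decided_below:
  assumes det: "\<forall>A. sigma_projective 1 A \<longrightarrow> determined omega (omega_game A)"
    and "m \<le> n" "alternates_below n G" "sp_decided G n"
  shows "sp_decided G m"
  using assms(2)
proof (induction rule: inc_induct)
  case (step k)
  then have "alternates_below (Suc k) G"
    using alternates_below_mono[OF assms(3)] by simp
  then show ?case
    using step.IH by (rule sp_decided_before[OF det])
qed (rule assms(4))

lemma sp_decided_fixed_game:
  assumes det: "\<forall>A. sigma_projective 1 A \<longrightarrow> determined omega (omega_game A)"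
    and A: "sigma_projective n A"
  shows "sp_decided (fixed_game n A) m"
proof -
  have "n \<ge> 1"
    by (rule sigma_projective_pos[OF A])
  have *: "sp_decided (fixed_game n A) m" if "n \<le> m" for m
  proof -
    have "sigma_projective m {x \<in> extensional {..<m}. restrict x {..<n} \<in> A}"
      using \<open>n \<ge> 1\<close> that
      by (intro sigma_projective_preimage[OF A] continuous_map_restrict) auto
    moreover have "decides PlayerI (fixed_game n A) m {x \<in> extensional {..<m}. restrict x {..<n} \<in> A}"
      using decides_fixed_game[OF that] by (rule iffD1[OF decides_cong, rotated]) simp
    ultimately show ?thesis
      unfolding sp_decided_def by blast
  qed
  show ?thesis
    by (cases "n \<le> m") (use * sp_decided_below[OF det, of m n] in auto)
qed

text \<open>After the choice, pull back the sets of the chosen game; at the choice, take a union or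
  an intersection; before it, go back over alternating blocks.\<close>

lemma sp_decided_choice_game:
  assumes det: "\<forall>A. sigma_projective 1 A \<longrightarrow> determined omega (omega_game A)"
    and G: "\<And>i m. sp_decided (G i) m"
  shows "sp_decided (choice_game P n G) m"
proof -
  obtain W where sp: "\<And>i m. m \<ge> 1 \<Longrightarrow> sigma_projective m (W m i)"
    and W: "\<And>i m. decides PlayerI (G i) m (W m i)"
    using G unfolding sp_decided_def by metis
  consider "m \<le> n" | "n < m"
    by linarith
  then show ?thesis
  proof cases
    case 1
    have "sp_decided (choice_game P n G) n"
      unfolding sp_decided_def
      using decides_choice_game_at[of PlayerI G n "W n" P, OF W] sp
      by (auto intro!: exI[of _ "if PlayerI = P then \<Union>i. W n i else \<Inter>i. W n i"]
          sp_Union sigma_projective_Inter)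
    then show ?thesis
      by (rule sp_decided_below[OF det 1 alternates_below_choice_game])
  next
    case 2
    then have "m \<ge> 1"
      by simp
    \<comment> \<open>The set \<open>W m i\<close> varies with the entry \<open>x n 0\<close>, so
      the pullback is split into countably many cases.\<close>
    define V where "V = (\<Union>i. {x \<in> extensional {..<m}. x n 0 \<in> {i}} \<inter>
      {x \<in> extensional {..<m}. x(n := \<lambda>b. x n (Suc b)) \<in> W m i})"
    have "continuous_map (baire_pow m) (baire_pow m) (\<lambda>x. x(n := \<lambda>b. x n (Suc b)))"
    proof (rule continuous_map_baire_powI)
      show "continuous_discrete (baire_pow m) (\<lambda>x. (x(n := \<lambda>b. x n (Suc b))) a b)" if "a < m" for a b
        using that by (cases "a = n") (auto intro: continuous_coordinate)
    qed (use 2 in \<open>auto simp: extensional_def\<close>)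
    then have "sigma_projective m {x \<in> extensional {..<m}. x(n := \<lambda>b. x n (Suc b)) \<in> W m i}" for i
      using sp \<open>m \<ge> 1\<close> by (intro sigma_projective_preimage)
    moreover have "sigma_projective m {x \<in> extensional {..<m}. x n 0 \<in> {i}}" for i
      using clopen_preimage_discrete[OF continuous_coordinate[OF 2], of 0 "{i}"] \<open>m \<ge> 1\<close>
      by (intro sp_open) (simp_all add: clopen_def)
    ultimately have "sigma_projective m V"
      unfolding V_def by (intro sp_Union sigma_projective_Int)
    moreover have "decides PlayerI (choice_game P n G) m V"
      using decides_choice_game_after[of n m PlayerI G "W m" P, OF 2 W]
      by (subst decides_cong[of _ _ "{x. x(n := \<lambda>b. x n (Suc b)) \<in> W m (x n 0)}"]) (auto simp: V_def)
    ultimately show ?thesis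
      unfolding sp_decided_def by blast
  qed
qed

lemma determined_simple_sigma_projective:
  assumes det: "\<forall>A. sigma_projective 1 A \<longrightarrow> determined omega (omega_game A)"
    and G: "simple_game sigma_projective G"
  shows "determined omega_sq G"
proof -
  have "sp_decided G m" for m
    using G by (induction arbitrary: m rule: simple_game.induct)
      (auto intro: sp_decided_fixed_game[OF det] sp_decided_choice_game[OF det])
  then show ?thesis
    unfolding sp_decided_def by (blast intro: determined_if_decides)
qed

section \<open>From simple clopen games to games of length \<open>\<omega>\<close>\<close>

text \<open>With \<open>P\<close> as a parameter, complements are handled by exchanging the
  players.\<close>

definition clopen_representable :: "player \<Rightarrow> nat \<Rightarrow> (nat \<Rightarrow> nat \<Rightarrow> nat) set \<Rightarrow> bool" where
  "clopen_representable P m W \<longleftrightarrow>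
    (\<exists>G. simple_game clopen G \<and> alternates_below m G \<and> decides P G m W)"

lemma clopen_representable_opponent:
  "clopen_representable (opponent P) m W \<longleftrightarrow> clopen_representable P m (- W)"
  by (simp add: clopen_representable_def decides_opponent)

lemma clopen_representable_cong:
  assumes "\<And>x. x \<in> extensional {..<m} \<Longrightarrow> x \<in> V \<longleftrightarrow> x \<in> W"
  shows "clopen_representable P m V \<longleftrightarrow> clopen_representable P m W"
  using decides_cong[of m V W] assms by (simp add: clopen_representable_def)

lemma clopen_representable_clopen:
  assumes "clopen m A"
  shows "clopen_representable P m A"
proof -
  have *: "clopen_representable PlayerI m A" if "clopen m A" for A
  proof -
    have "decides PlayerI (fixed_game m A) m A"
      using decides_fixed_game[of m m A]
      by (subst decides_cong[of _ _ "{x. restrict x {..<m} \<in> A}"]) (auto simp: extensional_restrict)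
    then show ?thesis
      using simple_fixed[of clopen m A, OF that] by (auto simp: clopen_representable_def)
  qed
  show ?thesis
  proof (cases P)
    case PlayerII
    have "clopen_representable (opponent PlayerI) m A"
      unfolding clopen_representable_opponent
      using *[OF clopen_Compl[OF assms]] by (subst clopen_representable_cong) auto
    then show ?thesis
      by (simp add: PlayerII)
  qed (use * assms in auto)
qed

text \<open>\<open>P\<close> claims membership in the union by naming an \<open>i\<close> at move
  number \<omega> \<cdot> m.\<close>

lemma clopen_representable_Union:
  assumes "\<And>i::nat. clopen_representable P m (W i)"
  shows "clopen_representable P m (\<Union>i. W i)"
proof -
  obtain G where G: "\<And>i. simple_game clopen (G i)" "\<And>i. decides P (G i) m (W i)"
    using assms unfolding clopen_representable_def by metis
  have "simple_game clopen (choice_game P m G)"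
    using G(1) by (cases P) (auto intro: simple_choice_I simple_choice_II)
  moreover have "decides P (choice_game P m G) m (\<Union>i. W i)"
    using decides_choice_game_at[of P G m W P, OF G(2)] by simp
  ultimately show ?thesis
    unfolding clopen_representable_def by (blast intro: alternates_below_choice_game)
qed

text \<open>The player \<open>P\<close>, who owns every second move of block \<open>m\<close>, plays a witness there; the moves of
  the opponent in this block are ignored.\<close>

definition moves :: "player \<Rightarrow> (nat \<Rightarrow> nat) \<Rightarrow> nat \<Rightarrow> nat" where
  "moves P v b = v (2 * b + (if P = PlayerI then 0 else 1))"

lemma moves_eqI:
  assumes "\<And>k. alternate k = P \<Longrightarrow> v k = w (k div 2)"
  shows "moves P v = w"
  using assms by (cases P) (auto simp: moves_def alternate_def fun_eq_iff)

lemma clopen_representable_Ex: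
  assumes "clopen_representable P (Suc m) {z. (restrict z {..<m})(m := moves P (z m)) \<in> B}"
  shows "clopen_representable P m {x. \<exists>v. x(m := v) \<in> B}"
proof -
  obtain G where G: "simple_game clopen G" "alternates_below (Suc m) G"
    and dec: "decides P G (Suc m) {z. (restrict z {..<m})(m := moves P (z m)) \<in> B}"
    using assms unfolding clopen_representable_def by blast
  have "restrict (blocks (Suc m) y) {..<m} = blocks m y" "blocks (Suc m) y m = (\<lambda>b. y (m, b))" for y
    by (simp_all add: blocks_Suc restrict_upd_eq extensional_restrict)
  then have blocks: "(blocks (Suc m) y \<in> {z. (restrict z {..<m})(m := moves P (z m)) \<in> B}) \<longleftrightarrow>
      (blocks m y)(m := moves P (\<lambda>b. y (m, b))) \<in> B" for y
    by (simp only: mem_Collect_eq)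
  have eq: "blocks m y = blocks m x" if "\<And>j. j \<in> before m \<Longrightarrow> y j = x j" for x y
    using that by (rule blocks_cong)
  have "decides P G m {x. \<exists>v. x(m := v) \<in> B}"
    unfolding decides_def mem_Collect_eq
  proof (intro allI conjI impI)
    fix x assume "\<exists>v. (blocks m x)(m := v) \<in> B"
    then obtain v where v: "(blocks m x)(m := v) \<in> B"
      by blast
    show "wins P G (before m) x"
    \<comment> \<open>Moves \<open>2 * b\<close> and \<open>2 * b + 1\<close> both have
      \<open>k div 2 = b\<close>, so the own moves of \<open>P\<close> spell out \<open>v\<close>
      for either player.\<close>
    proof (rule wins_before_block[OF G(2), where s = "\<lambda>k _. v (k div 2)"])
      fix y assume y: "\<And>j. j \<in> before m \<Longrightarrow> y j = x j" "\<And>k. alternate k = P \<Longrightarrow> y (m, k) = v (k div 2)"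
      then have "(blocks m y)(m := moves P (\<lambda>b. y (m, b))) \<in> B"
        using v by (simp only: eq[OF y(1)] moves_eqI)
      then show "wins P G (before (Suc m)) y"
        using dec unfolding decides_def blocks by blast
    qed
  next
    fix x assume x: "\<nexists>v. (blocks m x)(m := v) \<in> B"
    show "wins (opponent P) G (before m) x"
    \<comment> \<open>Any strategy serves in this block, since nothing that \<open>P\<close> can
      play is a witness.\<close>
    proof (rule wins_before_block[OF G(2), where s = undefined])
      fix y assume y: "\<And>j. j \<in> before m \<Longrightarrow> y j = x j"
      have "(blocks m y)(m := moves P (\<lambda>b. y (m, b))) \<notin> B"
        using x by (simp only: eq[OF y]) blast
      then show "wins (opponent P) G (before (Suc m)) y"
        using dec unfolding decides_def blocks by blast
    qed
  qed
  then show ?thesis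
    using G alternates_below_mono[OF G(2), of m] unfolding clopen_representable_def by auto
qed

text \<open>In the case of a projection, the induction hypothesis is applied to a preimage of the projected
  set, because the witness is read off the moves of one player only.\<close>

lemma clopen_representable_sigma_projective:
  assumes "sigma_projective k A" "continuous_map (baire_pow j) (baire_pow k) f"
  shows "clopen_representable P j {x. f x \<in> A}"
  using assms
proof (induction arbitrary: j f P rule: sigma_projective.induct)
  case (sp_open k A)
  have "openin (baire_pow j) {x \<in> topspace (baire_pow j). f x \<in> A}"
    by (rule openin_continuous_map_preimage[OF sp_open(3,2)])
  then obtain C where C: "\<And>i::nat. clopen j (C i)" "{x \<in> topspace (baire_pow j). f x \<in> A} = (\<Union>i. C i)"
    using openin_baire_pow_imp_Union_clopen by blast
  have "clopen_representable P j {x \<in> topspace (baire_pow j). f x \<in> A}"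
    unfolding C(2) by (intro clopen_representable_Union clopen_representable_clopen C(1))
  then show ?case
    by (rule iffD1[OF clopen_representable_cong, rotated]) simp
next
  case (sp_compl k A)
  \<comment> \<open>A game that decides the set for the opponent decides its complement for
    \<open>P\<close>.\<close>
  have "clopen_representable P j (- {x. f x \<in> A})"
    using sp_compl.IH[OF sp_compl.prems, of "opponent P"] by (simp add: clopen_representable_opponent)
  then show ?case
    using continuous_map_funspace[OF sp_compl.prems]
    by (subst clopen_representable_cong[of _ _ "- {x. f x \<in> A}"]) auto
next
  case (sp_Union k A)
  have "{x. f x \<in> (\<Union>i. A i)} = (\<Union>i. {x. f x \<in> A i})"
    by auto
  then show ?case
    using clopen_representable_Union[OF sp_Union.IH[OF sp_Union.prems]] by simp
next
  case (sp_proj k A)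
  \<comment> \<open>Block \<open>j\<close> supplies, through the moves of \<open>P\<close>, the
    coordinate \<open>k\<close> that the projection drops.\<close>
  define g where "g z = (f (restrict z {..<j}))(k := moves P (z j))" for z
  have "continuous_map (baire_pow (Suc j)) (baire_pow k) (\<lambda>z. f (restrict z {..<j}))"
    using continuous_map_compose[OF continuous_map_restrict sp_proj.prems, of "Suc j"]
    by (simp add: o_def)
  then have "continuous_map (baire_pow (Suc j)) (baire_pow (Suc k)) g"
    unfolding g_def by (rule continuous_map_upd) (simp add: continuous_coordinate moves_def)
  from sp_proj.IH[OF this, of P]
  have "clopen_representable P (Suc j) {z. g z \<in> A}" .
  also have "{z. g z \<in> A} = {z. (restrict z {..<j})(j := moves P (z j)) \<in>
      {z. (f (restrict z {..<j}))(k := z j) \<in> A}}"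
    by (simp add: g_def restrict_upd_eq)
  finally have "clopen_representable P j
      {x. \<exists>v. x(j := v) \<in> {z. (f (restrict z {..<j}))(k := z j) \<in> A}}"
    by (rule clopen_representable_Ex)
  moreover have "(\<exists>v. x(j := v) \<in> {z. (f (restrict z {..<j}))(k := z j) \<in> A}) \<longleftrightarrow>
      f x \<in> (\<lambda>x. restrict x {..<k}) ` A" if x: "x \<in> extensional {..<j}" for x
  proof -
    have "f x \<in> extensional {..<k}"
      using continuous_map_funspace[OF sp_proj.prems] x by (simp add: Pi_iff)
    moreover have "A \<subseteq> extensional {..<Suc k}"
      using sigma_projective_subset[OF sp_proj.hyps(2)] by (simp only: topspace_baire_pow)
    ultimately show ?thesis
      using x by (simp add: image_restrict_eq_ex_upd restrict_upd_eq extensional_restrict del: lessThan_Suc)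
  qed
  ultimately show ?case
    by (subst clopen_representable_cong) auto
qed

section \<open>Closing the cycle of implications\<close>

lemma determined_sigma_projective:
  assumes det: "\<And>G. simple_game clopen G \<Longrightarrow> determined omega_sq G"
    and A: "sigma_projective 1 A"
  shows "determined omega (omega_game A)"
proof -
  have "clopen_representable PlayerI 1 {x. x \<in> A}"
    by (rule clopen_representable_sigma_projective[OF A]) simp
  then show ?thesis
    using det determined_omega_game_if_decides unfolding clopen_representable_def by auto
qed

text \<open>Clopen sets are open, but \<open>sigma_projective\<close> starts at dimension 1. A game
  with \<open>n = 0\<close> has a constant outcome and is rewritten as one decided after one
  block.\<close>

lemma simple_sigma_projective_if_simple_clopen:
  assumes "simple_game clopen G"
  shows "simple_game sigma_projective G"
  using assms
proof (induction rule: simple_game.induct)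
  case (simple_fixed n A)
  show ?case
  proof (cases "n = 0")
    case True
    \<comment> \<open>\<open>\<lambda>_. undefined\<close> is the only point of the space of
      dimension 0.\<close>
    let ?B = "if (\<lambda>_. undefined) \<in> A then topspace (baire_pow 1) else {}"
    have "fixed_game n A = fixed_game 1 ?B"
      by (auto simp: fixed_game_def True restrict_def extensional_def)
    moreover have "sigma_projective 1 ?B"
      using openin_topspace[of "baire_pow 1"] by (intro sp_open) simp_all
    ultimately show ?thesis
      by (metis simple_game.simple_fixed)
  next
    case False
    then show ?thesis
      using simple_fixed by (intro simple_game.simple_fixed sp_open) (auto simp: clopen_def)
  qed
qed (auto intro: simple_choice_I simple_choice_II)

theorem theorem2p4:
  shows "((\<forall>A. sigma_projective 1 A \<longrightarrow> determined omega (omega_game A)) \<longleftrightarrow>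
          (\<forall>G. simple_game sigma_projective G \<longrightarrow> determined omega_sq G)) \<and>
         ((\<forall>G. simple_game sigma_projective G \<longrightarrow> determined omega_sq G) \<longleftrightarrow>
          (\<forall>G. simple_game clopen G \<longrightarrow> determined omega_sq G))"
  using determined_simple_sigma_projective determined_sigma_projective
    simple_sigma_projective_if_simple_clopen by blast

end
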